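(* Let $\Omega=\{107, 163, 173, 277, 283, 317, 347, 523, 557, 563, 613, 653, 733, 773, 787, 877, 907, 997\}$ and let $N \geq 2$ be an integer. (i) If $N$ is prime or $N \in \{4, 6, 8, 12, 24\}$, then $N$ is monomially irreducible. (ii) Suppose $N$ is even. Then $N$ is monomially irreducible if and only if $N \in \{2, 4, 6, 8, 12, 24\}$. (iii) Suppose $N$ is odd and not prime. If $N$ is monomially irreducible, then $N$ is of the form $\prod_{i=1}^{r} p_{i}$, where $r \geq 2$ and the $p_{i}$ are pairwise distinct odd primes satisfying the following conditions: - for all $i \in \{1,\ldots,r\}$, $p_{i} \equiv \pm 3 \pmod 5$; - for all $i \in \{1,\ldots,r\}$, $p_{i} \equiv \pm 3 \pmod 8$; - if $p_{i} \leq 1000$ then $p_{i} \in \Omega$.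
   Context: Let $N\ge 2$ be an integer. For $n \geq 1$ and $a_1,\ldots,a_n \in \mathbb{Z}/N\mathbb{Z}$, put $$M_{n}(a_{1},\ldots,a_{n})=\begin{pmatrix} a_{n} & -1 \\ 1 & 0 \end{pmatrix}\begin{pmatrix} a_{n-1} & -1 \\ 1 & 0 \end{pmatrix}\cdots\begin{pmatrix} a_{1} & -1 \\ 1 & 0 \end{pmatrix}.$$ A solution (of size $n$) of the equation $(E_N)$ is an $n$-tuple $(a_1,\ldots,a_n)\in(\mathbb{Z}/N\mathbb{Z})^n$ with $M_n(a_1,\ldots,a_n)=\pm \mathrm{Id}$ (over $\mathbb{Z}/N\mathbb{Z}$). Sum: $(a_{1},\ldots,a_{n}) \oplus (b_{1},\ldots,b_{m})= (a_{1}+b_{m},a_{2},\ldots,a_{n-1},a_{n}+b_{1},b_{2},\ldots,b_{m-1})$, which is an $(n+m-2)$-tuple. Equivalence: $(a_1,\ldots,a_n)\sim(b_1,\ldots,b_n)$ if $(b_1,\ldots,b_n)$ is obtained by a circular permutation of $(a_1,\ldots,a_n)$ or of $(a_n,\ldots,a_1)$. A solution $(c_1,\ldots,c_n)$ of $(E_N)$ with $n\ge 3$ is reducible if there exist a solution $(b_1,\ldots,b_l)$ of $(E_N)$ and an $m$-tuple $(a_1,\ldots,a_m)$ of elements of $\mathbb{Z}/N\mathbb{Z}$ with $m\ge 3$, $l\ge 3$ and $(c_1,\ldots,c_n)\sim (a_1,\ldots,a_m)\oplus(b_1,\ldots,b_l)$. A solution is irreducible if it is not reducible; $(0,0)$ is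 not considered irreducible. For $k\in\mathbb{Z}/N\mathbb{Z}$, the $k$-monomial minimal solution of $(E_N)$ is the $n$-tuple $(k,\ldots,k)$, where $n\ge 1$ is the smallest integer such that this $n$-tuple is a solution of $(E_N)$. A monomial minimal solution is a $k$-monomial minimal solution for some $k$; it is nonzero if $k\neq 0$. The integer $N\geq 2$ is monomially irreducible if all nonzero monomial minimal solutions of $(E_N)$ are irreducible; otherwise $N$ is monomially reducible. *)

theory Defs
  imports "HOL-Analysis.Analysis" "HOL-Number_Theory.Cong"
begin

text \<open>
  Elements of \<open>\<int>/N\<int>\<close> are represented by their canonical representatives
  \<open>0, \<dots>, N - 1\<close> in \<^typ>\<open>int\<close>, tuples over \<open>\<int>/N\<int>\<close> by lists of such integers, and
  equality of matrices over \<open>\<int>/N\<int>\<close> by entrywise congruence of integer matrices.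
\<close>

definition zmod_tuple :: "nat \<Rightarrow> int list \<Rightarrow> bool" where
  "zmod_tuple N a \<longleftrightarrow> set a \<subseteq> {0..<int N}"

definition elem_mat :: "int \<Rightarrow> int^2^2" where
  "elem_mat a = vector [vector [a, -1], vector [1, 0]]"

text \<open>The factor of the first tuple entry is the rightmost one.\<close>

fun tuple_mat :: "int list \<Rightarrow> int^2^2" where
  "tuple_mat [] = mat 1"
| "tuple_mat (a # as) = tuple_mat as ** elem_mat a"

definition mat_cong :: "nat \<Rightarrow> int^2^2 \<Rightarrow> int^2^2 \<Rightarrow> bool" where
  "mat_cong N A B \<longleftrightarrow> (\<forall>i j. [A $ i $ j = B $ i $ j] (mod int N))"

definition is_solution :: "nat \<Rightarrow> int list \<Rightarrow> bool" where
  "is_solution N a \<longleftrightarrow> a \<noteq> [] \<and> zmod_tuple N a \<and>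
     (mat_cong N (tuple_mat a) (mat 1) \<or> mat_cong N (tuple_mat a) (- mat 1))"

text \<open>Meaningful for tuples of length at least 2; only used for lengths at least 3.\<close>

definition tuple_sum :: "nat \<Rightarrow> int list \<Rightarrow> int list \<Rightarrow> int list" where
  "tuple_sum N a b =
     [(hd a + last b) mod int N] @ butlast (tl a) @
     [(last a + hd b) mod int N] @ butlast (tl b)"

definition tuple_equiv :: "int list \<Rightarrow> int list \<Rightarrow> bool" where
  "tuple_equiv a b \<longleftrightarrow> (\<exists>k. b = rotate k a \<or> b = rotate k (rev a))"

definition reducible_solution :: "nat \<Rightarrow> int list \<Rightarrow> bool" where
  "reducible_solution N c \<longleftrightarrow> is_solution N c \<and> length c \<ge> 3 \<and>
     (\<exists>a b. zmod_tuple N a \<and> length a \<ge> 3 \<and> is_solution N b \<and> length b \<ge> 3 \<and>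
        tuple_equiv c (tuple_sum N a b))"

definition irreducible_solution :: "nat \<Rightarrow> int list \<Rightarrow> bool" where
  "irreducible_solution N c \<longleftrightarrow>
     is_solution N c \<and> \<not> reducible_solution N c \<and> c \<noteq> [0, 0]"

definition monomial_minimal_solution :: "nat \<Rightarrow> int \<Rightarrow> int list \<Rightarrow> bool" where
  "monomial_minimal_solution N k c \<longleftrightarrow>
     (\<exists>n\<ge>1. c = replicate n k \<and> is_solution N c \<and>
        (\<forall>m. 1 \<le> m \<and> m < n \<longrightarrow> \<not> is_solution N (replicate m k)))"

definition monomially_irreducible :: "nat \<Rightarrow> bool" where
  "monomially_irreducible N \<longleftrightarrow>
     (\<forall>k\<in>{0..<int N}. k \<noteq> 0 \<longrightarrow>
        (\<forall>c. monomial_minimal_solution N k c \<longrightarrow> irreducible_solution N c))"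

definition Omega :: "nat set" where
  "Omega = {107, 163, 173, 277, 283, 317, 347, 523, 557, 563, 613, 653, 733, 773,
     787, 877, 907, 997}"

end

theory Submission
  imports Defs
begin

text \<open>
  For a constant tuple the matrix product is a power of one matrix, whose entries are the
  continuants \<open>u\<^sub>0 = 0\<close>, \<open>u\<^sub>1 = 1\<close>, \<open>u\<^sub>i\<^sub>+\<^sub>2 = k u\<^sub>i\<^sub>+\<^sub>1 - u\<^sub>i\<close>.
  The tuple \<open>(k, \<dots>, k)\<close> of size \<open>n\<close> is a solution iff \<open>u\<^sub>n = 0\<close> and \<open>u\<^sub>n\<^sub>+\<^sub>1 = \<plusminus>1\<close>, and it
  is reducible iff it has a summand \<open>(x, k, \<dots>, k, y)\<close>, for which the only condition is that
  \<open>u\<^sub>i\<^sub>+\<^sub>1 = \<plusminus>1\<close> for the number \<open>i\<close> of inner entries: the ends \<open>x\<close>, \<open>y\<close> can then be solved for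
  (\<open>reducible_replicate_iff\<close>).  Since \<open>u\<^sub>i\<^sub>+\<^sub>1 = \<plusminus>1\<close> together with \<open>u\<^sub>i = 0\<close> or \<open>u\<^sub>i\<^sub>+\<^sub>2 = 0\<close> means that
  the matrix power returns to \<open>\<plusminus>Id\<close> one step before or after, this gives a criterion in which the
  minimal size no longer occurs:

  \<open>N\<close> is monomially irreducible iff for all \<open>k\<close> and \<open>i\<close>, \<open>u\<^sub>i\<^sub>+\<^sub>1 = \<plusminus>1\<close> modulo \<open>N\<close> forces
  \<open>u\<^sub>i = 0\<close> or \<open>u\<^sub>i\<^sub>+\<^sub>2 = 0\<close> modulo \<open>N\<close>

  (\<open>not_monomially_irreducibleI\<close> and \<open>monomially_irreducibleI\<close>).  The determinant identity
  \<open>u\<^sub>i\<^sub>+\<^sub>1\<^sup>2 - u\<^sub>i u\<^sub>i\<^sub>+\<^sub>2 = 1\<close> turns the premise into \<open>u\<^sub>i u\<^sub>i\<^sub>+\<^sub>2 = 0\<close>, so primes satisfy the criterion, and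
  4, 6, 8, 12, 24 satisfy it by a finite check.

  Every other modulus violates it.  If \<open>d\<^sup>2\<close> divides \<open>N\<close> with \<open>d \<ge> 3\<close>, take \<open>k = N / d\<close>, whose square
  vanishes; then \<open>u\<^sub>3 = -1\<close> while \<open>u\<^sub>2 = k\<close> and \<open>u\<^sub>4 = -2k\<close> do not vanish
  (\<open>reducible_square_divisor\<close>).  If \<open>N = A B\<close> with coprime factors \<open>A \<ge> 2\<close>, \<open>B \<ge> 3\<close> and \<open>B\<close> prime to 6,
  glue by the Chinese remainder theorem the values \<open>k = 1\<close> modulo \<open>A\<close>, where \<open>u\<close> runs through
  \<open>0, 1, 1, 0, -1, -1\<close>, and \<open>k = 2\<close> modulo \<open>B\<close>, where \<open>u\<^sub>i = i\<close>.  An index \<open>i\<close> divisible by \<open>B\<close> and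
  congruent to 1 modulo 6 shows \<open>(1, 1, 0)\<close> modulo \<open>A\<close> and \<open>(0, 1, 2)\<close> modulo \<open>B\<close> at \<open>i, i + 1, i + 2\<close>:
  the middle value is 1 and neither neighbour is 0 modulo \<open>N\<close> (\<open>reducible_coprime_product\<close>).
  What escapes both constructions is a prime or a divisor of 24.  In particular a composite odd
  number is never monomially irreducible, and this is how the third part of the theorem is obtained.
\<close>

section \<open>Continuants\<close>

text \<open>
  Indices are shifted by one against the usual continuants, so that the size \<open>n\<close> of a constant
  solution is an index at which the sequence vanishes.
\<close>

fun cont :: "int \<Rightarrow> nat \<Rightarrow> int" where
  "cont k 0 = 0"
| "cont k (Suc 0) = 1"
| "cont k (Suc (Suc n)) = k * cont k (Suc n) - cont k n"

text \<open>The left-hand side is the determinant of the power of exponent \<open>i + 1\<close> of a matrix of determinant 1.\<close>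

lemma cont_det: "cont k (Suc i) ^ 2 - cont k i * cont k (Suc (Suc i)) = 1"
  by (induction i) (simp_all add: algebra_simps power2_eq_square)

lemma cont_cong:
  assumes "[k = k'] (mod m)"
  shows "[cont k i = cont k' i] (mod m)"
  using assms by (induction k i rule: cont.induct) (auto intro!: cong_diff cong_mult)

lemma cont_0: "cont 0 i = 0 \<or> cont 0 (Suc i) = 0"
  by (induction i) auto

lemma cont_2: "cont 2 i = int i"
  by (induction "2::int" i rule: cont.induct) auto

lemma cont_1_add_6: "cont 1 (i + 6 * q) = cont 1 i"
proof (induction q)
  case (Suc q)
  have "i + 6 * Suc q = Suc (Suc (Suc (Suc (Suc (Suc (i + 6 * q))))))"
    by simp
  then have "cont 1 (i + 6 * Suc q) = cont 1 (Suc (Suc (Suc (Suc (Suc (Suc (i + 6 * q)))))))"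
    by (simp only:)
  also have "\<dots> = cont 1 (i + 6 * q)"
    unfolding cont.simps by simp
  finally show ?case
    using Suc by simp
qed simp

lemma cont_shift:
  assumes "[cont k n = 0] (mod m)" "[cont k (Suc n) = e] (mod m)"
  shows "[cont k (n + i) = e * cont k i] (mod m)"
  using assms
proof (induction k i rule: cont.induct)
  case (3 k i)
  have "[k * cont k (Suc (n + i)) - cont k (n + i)
        = k * (e * cont k (Suc i)) - e * cont k i] (mod m)"
    using 3 by (intro cong_diff cong_mult) auto
  then show ?case by (simp add: algebra_simps)
qed auto

text \<open>
  The pairs of consecutive values modulo \<open>m\<close> are finitely many, so one recurs; as the recurrence can
  also be run backwards, the initial pair recurs too.
\<close>

lemma cont_periodic:
  assumes "m > 0"
  obtains n where "n \<ge> 1" "[cont k n = 0] (mod m)" "[cont k (Suc n) = 1] (mod m)"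
proof -
  define s where "s i = (cont k i mod m, cont k (Suc i) mod m)" for i
  have "range s \<subseteq> {0..<m} \<times> {0..<m}"
    using assms by (auto simp: s_def)
  then have "finite (range s)"
    by (rule finite_subset) simp
  then have "\<not> inj s"
    using finite_imageD[of s UNIV] by auto
  then obtain a b where ab: "a < b" "s a = s b"
    unfolding inj_def by (metis linorder_neqE_nat)
  have "s i = s (i + d) \<Longrightarrow> s 0 = s d" for i d
  proof (induction i)
    case (Suc i)
    have prev: "cont k j = k * cont k (Suc j) - cont k (Suc (Suc j))" for j
      by simp
    have eqs: "[cont k (Suc i) = cont k (Suc (i + d))] (mod m)"
      "[cont k (Suc (Suc i)) = cont k (Suc (Suc (i + d)))] (mod m)"
      using Suc.prems by (auto simp: s_def cong_def simp del: cont.simps)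
    have "[cont k i = cont k (i + d)] (mod m)"
      unfolding prev[of i] prev[of "i + d"] using eqs by (intro cong_diff cong_mult) auto
    with eqs(1) have "s i = s (i + d)"
      by (simp add: s_def cong_def)
    then show ?case by (rule Suc.IH)
  qed simp
  from this[of a "b - a"] ab have "s 0 = s (b - a)"
    by simp
  then show thesis
    using ab by (intro that[of "b - a"]) (auto simp: s_def cong_def)
qed

section \<open>Solutions and continuants\<close>

lemma mat_cong_2:
  "mat_cong N A B \<longleftrightarrow>
     [A $ 1 $ 1 = B $ 1 $ 1] (mod int N) \<and> [A $ 1 $ 2 = B $ 1 $ 2] (mod int N) \<and>
     [A $ 2 $ 1 = B $ 2 $ 1] (mod int N) \<and> [A $ 2 $ 2 = B $ 2 $ 2] (mod int N)"
  unfolding mat_cong_def by (auto simp: forall_2)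

lemma tuple_mat_append: "tuple_mat (a @ b) = tuple_mat b ** tuple_mat a"
  by (induction a) (simp_all add: matrix_mul_assoc)

lemma elem_mat_nth:
  "elem_mat a $ 1 $ 1 = a" "elem_mat a $ 1 $ 2 = - 1"
  "elem_mat a $ 2 $ 1 = 1" "elem_mat a $ 2 $ 2 = 0"
  by (simp_all add: elem_mat_def)

lemma mult_nth_2: "((A :: int^2^2) ** B) $ i $ j = A $ i $ 1 * B $ 1 $ j + A $ i $ 2 * B $ 2 $ j"
  by (simp add: matrix_matrix_mult_def sum_2)

lemma tuple_mat_replicate:
  "tuple_mat (replicate n k) $ 1 $ 1 = cont k (Suc n)"
  "tuple_mat (replicate n k) $ 1 $ 2 = - cont k n"
  "tuple_mat (replicate n k) $ 2 $ 1 = cont k n"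
  "tuple_mat (replicate n k) $ 2 $ 2 = cont k (Suc n) - k * cont k n"
  by (induction n) (simp_all add: mult_nth_2 elem_mat_nth mat_def algebra_simps)

lemma is_solution_replicate_iff:
  "is_solution N (replicate n k) \<longleftrightarrow>
     n \<ge> 1 \<and> k \<in> {0..<int N} \<and> [cont k n = 0] (mod int N) \<and>
     ([cont k (Suc n) = 1] (mod int N) \<or> [cont k (Suc n) = - 1] (mod int N))"
proof -
  have *: "mat_cong N (tuple_mat (replicate n k)) (mat e) \<longleftrightarrow>
      [cont k n = 0] (mod int N) \<and> [cont k (Suc n) = e] (mod int N)" for e
  proof
    assume asm: "[cont k n = 0] (mod int N) \<and> [cont k (Suc n) = e] (mod int N)"
    then have "[cont k (Suc n) - k * cont k n = e - k * 0] (mod int N)"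
      by (intro cong_diff cong_mult) auto
    moreover from asm have "[- cont k n = 0] (mod int N)"
      using cong_minus_minus_iff[of "cont k n" 0] by simp
    ultimately show "mat_cong N (tuple_mat (replicate n k)) (mat e)"
      using asm by (simp add: mat_cong_2 tuple_mat_replicate mat_def)
  qed (simp add: mat_cong_2 tuple_mat_replicate mat_def)
  have "- mat 1 = (mat (- 1) :: int^2^2)"
    by (simp add: vec_eq_iff mat_def)
  then show ?thesis
    unfolding is_solution_def zmod_tuple_def using *[of 1] *[of "- 1"] by (cases n) auto
qed

text \<open>
  A summand that can be split off a constant tuple is constant except at its two ends, which absorb
  the carries of the sum.
\<close>

lemma tuple_mat_sandwich:
  "tuple_mat (x # replicate j k @ [y]) $ 2 $ 2 = - cont k (Suc j)"
  "tuple_mat (x # replicate j k @ [y]) $ 2 $ 1 = x * cont k (Suc j) - cont k j"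
  "tuple_mat (x # replicate j k @ [y]) $ 1 $ 2 = cont k j - y * cont k (Suc j)"
  "tuple_mat (x # replicate j k @ [y]) $ 1 $ 1 =
     y * (x * cont k (Suc j) - cont k j) - (x * cont k j + cont k (Suc j) - k * cont k j)"
  by (simp_all add: tuple_mat_append mult_nth_2 elem_mat_nth tuple_mat_replicate mat_def algebra_simps
        del: cont.simps)

text \<open>
  With \<open>u\<^sub>j\<^sub>+\<^sub>1 = e = \<plusminus>1\<close>, the vanishing of the two off-diagonal entries determines both ends as
  \<open>e u\<^sub>j\<close>; the determinant identity then fixes the remaining diagonal entry.
\<close>

lemma sandwich_solution:
  assumes "N \<ge> 2" "k \<in> {0..<int N}"
    and e: "[cont k (Suc j) = e] (mod int N)" "e = 1 \<or> e = - 1"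
  obtains x where "is_solution N (x # replicate j k @ [x])"
proof -
  define x where "x = e * cont k j mod int N"
  have ee: "e * e = 1" using e by auto
  have x: "[x = e * cont k j] (mod int N)"
    by (simp add: x_def)
  have c1: "[x * cont k (Suc j) = e * cont k j * e] (mod int N)"
    using x e by (intro cong_mult)
  then have c1: "[x * cont k (Suc j) = cont k j] (mod int N)"
    using e(2) by auto
  have d1: "[x * cont k (Suc j) - cont k j = 0] (mod int N)"
    using c1 by (simp add: cong_iff_dvd_diff)
  have d2: "[cont k j - x * cont k (Suc j) = 0] (mod int N)"
    using cong_sym[OF c1] by (simp add: cong_iff_dvd_diff)
  have det: "cont k j * (k * cont k (Suc j) - cont k j) = e * e - 1 + (cont k (Suc j) ^ 2 - e ^ 2)"
    using cont_det[of k j] ee by (simp add: power2_eq_square algebra_simps)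
  have sq: "[cont k (Suc j) ^ 2 = e ^ 2] (mod int N)"
    using e by (intro cong_pow)
  \<comment> \<open>the diagonal entry that contains both ends: reduce it to \<open>e * (e * e - 1) - e\<close>\<close>
  have "[x * (x * cont k (Suc j) - cont k j) - (x * cont k j + cont k (Suc j) - k * cont k j)
        = x * 0 - (e * cont k j * cont k j + e - k * cont k j)] (mod int N)"
    using d1 x e by (intro cong_diff cong_mult cong_add cong_refl)
  also have "x * 0 - (e * cont k j * cont k j + e - k * cont k j)
        = e * (cont k j * (k * e - cont k j)) - e"
    using e(2) by (auto simp: algebra_simps)
  also have "[e * (cont k j * (k * e - cont k j)) - e
        = e * (cont k j * (k * cont k (Suc j) - cont k j)) - e] (mod int N)"
    using cong_sym[OF e(1)] by (intro cong_diff cong_mult) auto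
  also have "[e * (cont k j * (k * cont k (Suc j) - cont k j)) - e = e * 0 - e] (mod int N)"
    using det sq ee by (intro cong_diff cong_mult) (auto simp: cong_iff_dvd_diff)
  finally have d3: "[x * (x * cont k (Suc j) - cont k j) - (x * cont k j + cont k (Suc j) - k * cont k j)
        = - e] (mod int N)" by simp
  have d4: "[- cont k (Suc j) = - e] (mod int N)"
    using e by (simp add: cong_minus_minus_iff)
  have "is_solution N (x # replicate j k @ [x])"
    unfolding is_solution_def zmod_tuple_def mat_cong_2 tuple_mat_sandwich
    using e(2) d1 d2 d3 d4 assms by (auto simp: mat_def x_def simp del: cont.simps)
  then show thesis by (rule that)
qed

lemma split_ends: "length b \<ge> 3 \<Longrightarrow> b = hd b # butlast (tl b) @ [last b]"
  by (cases b) (auto split: if_splits)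

text \<open>
  The bound \<open>j + 3 \<le> n\<close> is the length condition on the first summand, which has \<open>n - j\<close> entries.
\<close>

lemma reducible_replicate_iff:
  assumes "N \<ge> 2" "is_solution N (replicate n k)"
  shows "reducible_solution N (replicate n k) \<longleftrightarrow>
     (\<exists>j. 1 \<le> j \<and> j + 3 \<le> n \<and>
        ([cont k (Suc j) = 1] (mod int N) \<or> [cont k (Suc j) = - 1] (mod int N)))"
    (is "?L \<longleftrightarrow> ?R")
proof
  assume ?L
  then obtain a b where ab: "length a \<ge> 3" "is_solution N b" "length b \<ge> 3"
    and eq: "tuple_equiv (replicate n k) (tuple_sum N a b)"
    unfolding reducible_solution_def by blast
  from eq have sum: "tuple_sum N a b = replicate n k"
    by (auto simp: tuple_equiv_def intro!: replicate_eqI)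
  have "length (tuple_sum N a b) = n"
    by (simp add: sum)
  then have len: "length a + length b = n + 2"
    using ab by (simp add: tuple_sum_def)
  define j where "j = length b - 2"
  have "set (butlast (tl b)) \<subseteq> set (tuple_sum N a b)"
    by (auto simp: tuple_sum_def)
  then have "butlast (tl b) = replicate j k"
    by (intro replicate_eqI) (auto simp: sum j_def)
  with split_ends[OF ab(3)] obtain x y where b: "b = x # replicate j k @ [y]"
    by metis
  have "[- cont k (Suc j) = 1] (mod int N) \<or> [- cont k (Suc j) = - 1] (mod int N)"
    using ab(2) unfolding is_solution_def mat_cong_2 b tuple_mat_sandwich by (auto simp: mat_def)
  then have "[cont k (Suc j) = - 1] (mod int N) \<or> [cont k (Suc j) = 1] (mod int N)"
    using cong_minus_minus_iff[of "cont k (Suc j)" "- 1" "int N"]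
      cong_minus_minus_iff[of "cont k (Suc j)" "1" "int N"] by auto
  then show ?R
    using ab len by (intro exI[of _ j]) (auto simp: j_def)
next
  assume ?R
  then obtain j e where j: "1 \<le> j" "j + 3 \<le> n" and e: "[cont k (Suc j) = e] (mod int N)"
    "e = 1 \<or> e = - 1" by blast
  have k: "k \<in> {0..<int N}"
    using assms by (simp add: is_solution_replicate_iff)
  obtain x where x: "is_solution N (x # replicate j k @ [x])"
    using sandwich_solution[OF assms(1) k e] .
  define b where "b = x # replicate j k @ [x]"
  \<comment> \<open>the other summand has the ends \<open>k - x\<close>, so that the sum restores \<open>k\<close> where the ends meet\<close>
  define z where "z = (k - x) mod int N"
  define a where "a = z # replicate (n - j - 2) k @ [z]"
  have "(z + x) mod int N = k"
    using k by (simp add: z_def mod_simps)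
  then have "tuple_sum N a b = [k] @ replicate (n - j - 2) k @ [k] @ replicate j k"
    by (simp add: tuple_sum_def a_def b_def butlast_append add.commute)
  also have "\<dots> = replicate n k"
    using j by (intro replicate_eqI) auto
  finally have "tuple_equiv (replicate n k) (tuple_sum N a b)"
    by (auto simp: tuple_equiv_def intro!: exI[of _ 0])
  moreover have "zmod_tuple N a"
    using k assms(1) by (auto simp: zmod_tuple_def a_def z_def)
  moreover have "length a \<ge> 3" "length b \<ge> 3"
    using j by (simp_all add: a_def b_def)
  ultimately show ?L
    using x assms j unfolding reducible_solution_def b_def[symmetric] by auto
qed

section \<open>A criterion for monomial irreducibility\<close>

text \<open>
  Any index with this pattern yields a reducible solution: modulo the minimal size \<open>n\<close>, the sequence
  \<open>u\<close> repeats up to sign, so the pattern moves to an index \<open>r < n\<close>.  As \<open>u\<close> vanishes at \<open>0\<close> and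
  \<open>n\<close>, none of \<open>r\<close>, \<open>r + 1\<close>, \<open>r + 2\<close> is one of these two, which leaves exactly the range of
  admissible splittings.
\<close>

lemma not_monomially_irreducibleI:
  assumes N: "N \<ge> 2"
    and unit: "[cont k (Suc i) = 1] (mod int N) \<or> [cont k (Suc i) = - 1] (mod int N)"
    and nz: "\<not> [cont k i = 0] (mod int N)" "\<not> [cont k (Suc (Suc i)) = 0] (mod int N)"
  shows "\<not> monomially_irreducible N"
proof
  assume irr: "monomially_irreducible N"
  define h where "h = k mod int N"
  have h: "h \<in> {0..<int N}" using N by (simp add: h_def)
  define u where "u i = cont h i" for i
  have u: "[cont k i = u i] (mod int N)" for i
    unfolding u_def by (rule cont_cong) (simp add: h_def cong_def)
  define P where "P i \<longleftrightarrow> ([u (Suc i) = 1] (mod int N) \<or> [u (Suc i) = - 1] (mod int N)) \<and>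
    \<not> [u i = 0] (mod int N) \<and> \<not> [u (Suc (Suc i)) = 0] (mod int N)" for i
  have "P i"
    unfolding P_def using unit nz u by (meson cong_sym cong_trans)
  have nontriv: "\<not> [0 = 1] (mod int N)" "\<not> [0 = - 1] (mod int N)"
    using N by (auto simp: cong_iff_dvd_diff zdvd_not_zless)
  have "h \<noteq> 0"
  proof
    assume "h = 0"
    then have "u i = 0 \<or> u (Suc i) = 0"
      using cont_0 by (simp add: u_def)
    with \<open>P i\<close> nontriv show False
      unfolding P_def by auto
  qed
  define S where "S n \<longleftrightarrow> is_solution N (replicate n h)" for n
  define n where "n = (LEAST n. S n)"
  have "\<exists>n. S n"
    using cont_periodic[of "int N" h] N h unfolding S_def is_solution_replicate_iff
    by (metis less_le_trans of_nat_0_less_iff zero_less_numeral)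
  then have "S n" unfolding n_def by (auto intro: LeastI)
  have min: "\<not> S m" if "m < n" for m
    using that unfolding n_def by (rule not_less_Least)
  from \<open>S n\<close> obtain e where n: "n \<ge> 1" "[u n = 0] (mod int N)" "[u (Suc n) = e] (mod int N)"
    and e: "e = 1 \<or> e = - 1"
    unfolding S_def is_solution_replicate_iff u_def by blast
  define r where "r = (LEAST i. P i)"
  have "P r" unfolding r_def using \<open>P i\<close> by (rule LeastI)
  have shift: "[u (n + j) = e * u j] (mod int N)" for j
    using cont_shift n unfolding u_def by blast
  have shift': "[u (n + j) = c] (mod int N) \<longleftrightarrow> [u j = e * c] (mod int N)" for j c
  proof -
    have "[u (n + j) = c] (mod int N) \<longleftrightarrow> [e * u j = c] (mod int N)"
      using shift by (meson cong_sym cong_trans)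
    also have "\<dots> \<longleftrightarrow> [u j = e * c] (mod int N)"
      using e cong_minus_minus_iff[of "u j" "- c"] by auto
    finally show ?thesis .
  qed
  have "r < n"
  proof (rule ccontr)
    assume "\<not> r < n"
    then obtain s where s: "r = n + s" using le_Suc_ex not_less by blast
    have "P s"
      using \<open>P r\<close> e shift'[of s 0] shift'[of "Suc s"] shift'[of "Suc (Suc s)" 0]
      unfolding P_def s by auto
    then have "r \<le> s" unfolding r_def by (rule Least_le)
    with s n show False by simp
  qed
  moreover have "r \<noteq> 0" using \<open>P r\<close> unfolding P_def u_def by (auto intro: ccontr)
  moreover have "Suc r \<noteq> n"
    using \<open>P r\<close> n(2) nontriv unfolding P_def by (meson cong_sym cong_trans)
  moreover have "Suc (Suc r) \<noteq> n"
    using \<open>P r\<close> n(2) unfolding P_def by blast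
  ultimately have "1 \<le> r" "r + 3 \<le> n" by auto
  then have "reducible_solution N (replicate n h)"
    using reducible_replicate_iff[OF N] \<open>S n\<close> \<open>P r\<close> unfolding S_def P_def u_def by blast
  moreover have "monomial_minimal_solution N h (replicate n h)"
    unfolding monomial_minimal_solution_def using n \<open>S n\<close> min by (auto simp: S_def)
  ultimately show False
    using irr h \<open>h \<noteq> 0\<close> unfolding monomially_irreducible_def irreducible_solution_def by blast
qed

text \<open>
  A splitting of the minimal solution at \<open>u\<^sub>i\<^sub>+\<^sub>1 = \<plusminus>1\<close> with \<open>u\<^sub>i = 0\<close> or \<open>u\<^sub>i\<^sub>+\<^sub>2 = 0\<close> would produce
  a shorter constant solution.  The minimality of \<open>n\<close> is kept in the hypothesis because it bounds the
  indices \<open>i\<close> that have to be inspected for a concrete modulus.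
\<close>

lemma monomially_irreducibleI:
  assumes N: "N \<ge> 2"
    and crit: "\<And>k n i. k \<in> {0..<int N} \<Longrightarrow> is_solution N (replicate n k) \<Longrightarrow>
      (\<And>m. m < n \<Longrightarrow> \<not> is_solution N (replicate m k)) \<Longrightarrow> i + 3 \<le> n \<Longrightarrow>
      [cont k (Suc i) = 1] (mod int N) \<or> [cont k (Suc i) = - 1] (mod int N) \<Longrightarrow>
      [cont k i = 0] (mod int N) \<or> [cont k (Suc (Suc i)) = 0] (mod int N)"
  shows "monomially_irreducible N"
  unfolding monomially_irreducible_def
proof (intro ballI impI allI)
  fix k c assume k: "k \<in> {0..<int N}" "k \<noteq> 0" and c: "monomial_minimal_solution N k c"
  obtain n where n: "n \<ge> 1" "c = replicate n k" "is_solution N (replicate n k)"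
    and "\<forall>m. 1 \<le> m \<and> m < n \<longrightarrow> \<not> is_solution N (replicate m k)"
    using c unfolding monomial_minimal_solution_def by blast
  then have min: "\<And>m. m < n \<Longrightarrow> \<not> is_solution N (replicate m k)"
    by (metis is_solution_replicate_iff)
  have "\<not> reducible_solution N c"
  proof
    assume "reducible_solution N c"
    then obtain j where j: "1 \<le> j" "j + 3 \<le> n"
      and unit: "[cont k (Suc j) = 1] (mod int N) \<or> [cont k (Suc j) = - 1] (mod int N)"
      using reducible_replicate_iff[OF N n(3)] n(2) by blast
    from crit[OF k(1) n(3) min j(2) unit] show False
    proof
      assume "[cont k j = 0] (mod int N)"
      then have "is_solution N (replicate j k)"
        using unit k j by (simp add: is_solution_replicate_iff del: cont.simps)
      with min[of j] j show False by simp
    next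
      assume z: "[cont k (Suc (Suc j)) = 0] (mod int N)"
      have next_eq: "[cont k (Suc (Suc (Suc j))) = k * 0 - e] (mod int N)"
        if "[cont k (Suc j) = e] (mod int N)" for e
        unfolding cont.simps(3)[of k "Suc j"] using z that by (intro cong_diff cong_mult cong_refl)
      have "is_solution N (replicate (Suc (Suc j)) k)"
        using unit k z next_eq[of 1] next_eq[of "- 1"]
        unfolding is_solution_replicate_iff by (auto simp del: cont.simps)
      with min[of "Suc (Suc j)"] j show False by simp
    qed
  qed
  moreover have "c \<noteq> [0, 0]"
    using k n by (metis in_set_replicate list.set_intros(1) not_one_le_zero)
  ultimately show "irreducible_solution N c"
    using n by (simp add: irreducible_solution_def)
qed

section \<open>Primes and divisors of 24\<close>

lemma monomially_irreducible_prime: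
  assumes "prime N"
  shows "monomially_irreducible N"
proof (rule monomially_irreducibleI)
  fix k i
  assume "[cont k (Suc i) = 1] (mod int N) \<or> [cont k (Suc i) = - 1] (mod int N)"
  then have "[cont k (Suc i) ^ 2 = 1] (mod int N)"
    using cong_pow[of "cont k (Suc i)" 1 "int N" 2] cong_pow[of "cont k (Suc i)" "- 1" "int N" 2]
    by auto
  then have "int N dvd cont k i * cont k (Suc (Suc i))"
    using cont_det[of k i] by (simp add: cong_iff_dvd_diff algebra_simps del: cont.simps)
  then show "[cont k i = 0] (mod int N) \<or> [cont k (Suc (Suc i)) = 0] (mod int N)"
    using assms by (simp add: cong_0_iff prime_dvd_mult_iff del: cont.simps)
qed (use assms prime_ge_2_nat in auto)

text \<open>
  An executable form of the criterion: starting from two consecutive reduced values \<open>x\<close>, \<open>y\<close>, it tests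
  \<open>s\<close> consecutive indices and finally that the matrix power has returned to \<open>\<plusminus>Id\<close>.
\<close>

fun check_orbit :: "int \<Rightarrow> int \<Rightarrow> nat \<Rightarrow> int \<Rightarrow> int \<Rightarrow> bool" where
  "check_orbit m k 0 x y \<longleftrightarrow> x = 0 \<and> (y = 1 \<or> y = m - 1)"
| "check_orbit m k (Suc s) x y \<longleftrightarrow>
     (let z = (k * y - x) mod m in
      ((y = 1 \<or> y = m - 1) \<longrightarrow> x = 0 \<or> z = 0) \<and> check_orbit m k s y z)"

lemma check_orbit_sound:
  assumes "check_orbit m k s (cont k i mod m) (cont k (Suc i) mod m)"
  defines "unit \<equiv> \<lambda>j. cont k (Suc j) mod m = 1 \<or> cont k (Suc j) mod m = m - 1"
  shows "cont k (i + s) mod m = 0 \<and> unit (i + s) \<and>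
    (\<forall>j\<in>{i..<i + s}. unit j \<longrightarrow> cont k j mod m = 0 \<or> cont k (Suc (Suc j)) mod m = 0)"
  using assms(1)
proof (induction s arbitrary: i)
  case (Suc s)
  have step: "(k * (cont k (Suc i) mod m) - cont k i mod m) mod m = cont k (Suc (Suc i)) mod m"
    unfolding cont.simps(3) by (rule mod_diff_cong) (simp_all only: mod_mult_right_eq mod_mod_trivial)
  have here: "unit i \<longrightarrow> cont k i mod m = 0 \<or> cont k (Suc (Suc i)) mod m = 0"
    and rest: "check_orbit m k s (cont k (Suc i) mod m) (cont k (Suc (Suc i)) mod m)"
    using Suc.prems unfolding check_orbit.simps Let_def step unit_def by blast+
  have "{i..<i + Suc s} = insert i {Suc i..<Suc i + s}"
    by auto
  then show ?case
    using Suc.IH[OF rest] here by (simp del: cont.simps)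
qed (simp add: unit_def del: cont.simps)

text \<open>
  The step count 24 serves all these moduli and all \<open>k\<close> at once: the 24th matrix power is always
  \<open>\<plusminus>Id\<close>.
\<close>

lemma check_orbit_24:
  "\<forall>m\<in>set [4, 6, 8, 12, 24]. \<forall>k\<in>set [0..m - 1]. check_orbit m k 24 0 1"
  by code_simp

lemma monomially_irreducible_divisor_24:
  assumes "N \<in> {4, 6, 8, 12, 24}"
  shows "monomially_irreducible N"
proof (rule monomially_irreducibleI)
  show N: "N \<ge> 2" using assms by auto
  fix k n i
  assume k: "k \<in> {0..<int N}"
    and min: "\<And>m. m < n \<Longrightarrow> \<not> is_solution N (replicate m k)" and i: "i + 3 \<le> n"
    and unit: "[cont k (Suc i) = 1] (mod int N) \<or> [cont k (Suc i) = - 1] (mod int N)"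
  have unit_iff: "([x = 1] (mod int N) \<or> [x = - 1] (mod int N)) \<longleftrightarrow>
      x mod int N = 1 \<or> x mod int N = int N - 1" for x
    using N by (simp add: cong_def zmod_minus1)
  have "check_orbit (int N) k 24 (cont k 0 mod int N) (cont k (Suc 0) mod int N)"
    using check_orbit_24 assms k by auto
  note orbit = check_orbit_sound[OF this, unfolded unit_iff[symmetric] add_0]
  then have "is_solution N (replicate 24 k)"
    unfolding is_solution_replicate_iff using k by (simp add: cong_def del: cont.simps)
  with min have "n \<le> 24" by (meson not_le)
  with i have "i \<in> {0..<24}" by simp
  with orbit unit have "cont k i mod int N = 0 \<or> cont k (Suc (Suc i)) mod int N = 0"
    by blast
  then show "[cont k i = 0] (mod int N) \<or> [cont k (Suc (Suc i)) = 0] (mod int N)"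
    by (simp add: cong_def del: cont.simps)
qed

section \<open>Reducible moduli\<close>

text \<open>
  The multiplier is 1 modulo \<open>A\<close> and 2 modulo \<open>B\<close>.  The coprimality of \<open>B\<close> and 6 lets the index be
  prescribed modulo the period 6 of the first sequence and modulo the period \<open>B\<close> of the second.
\<close>

lemma reducible_coprime_product:
  fixes A B :: nat
  assumes A: "A \<ge> 2" and B: "B \<ge> 3" and cop: "coprime A B" "coprime B 6"
  shows "\<not> monomially_irreducible (A * B)"
proof -
  obtain k :: int where k: "[k = 1] (mod int A)" "[k = 2] (mod int B)"
    using binary_chinese_remainder_int[of "int A" "int B" 1 2] cop by auto
  obtain i where i: "[i = 1] (mod 6)" "[i = 0] (mod B)"
    using binary_chinese_remainder_nat[of 6 B 1 0] cop by (auto simp: coprime_commute)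
  have "i mod 6 = 1" using i(1) by (simp add: cong_def)
  then obtain q where q: "i = 1 + 6 * q"
    by (metis mod_div_mult_eq mult.commute)
  have cA: "[cont k j = cont 1 j] (mod int A)" for j
    using k(1) by (rule cont_cong)
  have cB: "[cont k j = int j] (mod int B)" for j
    using cont_cong[OF k(2), of j] by (simp add: cont_2)
  have A0: "[cont k i = 1] (mod int A)" and A1: "[cont k (Suc i) = 1] (mod int A)"
    using cA[of i] cA[of "Suc i"] cont_1_add_6[of 1 q] cont_1_add_6[of "Suc 1" q]
    by (simp_all add: q)
  have iB: "[int (i + j) = int j] (mod int B)" for j
    using i(2) by (simp add: cong_0_iff cong_iff_dvd_diff)
  have B1: "[cont k (Suc i) = 1] (mod int B)"
    using cong_trans[OF cB iB, of 1] by simp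
  have B2: "[cont k (Suc (Suc i)) = 2] (mod int B)"
    using cong_trans[OF cB iB, of 2] by (simp del: cont.simps)
  show ?thesis
  proof (rule not_monomially_irreducibleI)
    have "2 * 3 \<le> A * B" using A B by (intro mult_mono) auto
    then show "A * B \<ge> 2" by simp
    show "[cont k (Suc i) = 1] (mod int (A * B)) \<or> [cont k (Suc i) = - 1] (mod int (A * B))"
      using coprime_cong_mult[OF A1 B1] cop by (simp del: cont.simps)
    show "\<not> [cont k i = 0] (mod int (A * B))"
    proof
      assume "[cont k i = 0] (mod int (A * B))"
      then have "[cont k i = 0] (mod int A)" by (auto intro: cong_modulus_mult)
      with A0 have "[1 = 0] (mod int A)" by (meson cong_sym cong_trans)
      with A show False by (auto simp: cong_0_iff zdvd_not_zless)
    qed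
    show "\<not> [cont k (Suc (Suc i)) = 0] (mod int (A * B))"
    proof
      assume "[cont k (Suc (Suc i)) = 0] (mod int (A * B))"
      then have "[cont k (Suc (Suc i)) = 0] (mod int B)"
        by (auto intro: cong_modulus_mult simp: mult.commute simp del: cont.simps)
      with B2 have "[2 = 0] (mod int B)" by (meson cong_sym cong_trans)
      with B show False by (auto simp: cong_0_iff zdvd_not_zless)
    qed
  qed
qed

text \<open>Modulo a divisor of \<open>k\<^sup>2\<close> the continuants start \<open>0, 1, k, -1, -2k\<close>.\<close>

lemma reducible_square_zero:
  assumes "N \<ge> 2" "[k ^ 2 = 0] (mod int N)" "\<not> [2 * k = 0] (mod int N)"
  shows "\<not> monomially_irreducible N"
proof (rule not_monomially_irreducibleI[where i = 2 and k = k])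
  have c: "cont k 2 = k" "cont k (Suc 2) = k ^ 2 - 1" "cont k (Suc (Suc 2)) = k * k ^ 2 - 2 * k"
    by (simp_all add: eval_nat_numeral algebra_simps)
  show "[cont k (Suc 2) = 1] (mod int N) \<or> [cont k (Suc 2) = - 1] (mod int N)"
    unfolding c using cong_diff[OF assms(2) cong_refl[of 1]] by simp
  show "\<not> [cont k 2 = 0] (mod int N)"
    unfolding c using assms by (auto simp: cong_0_iff)
  show "\<not> [cont k (Suc (Suc 2)) = 0] (mod int N)"
    unfolding c using assms(2,3) dvd_diff_right_iff[of "int N" "k * k ^ 2" "2 * k"]
    by (auto simp: cong_0_iff)
qed (use assms in auto)

lemma reducible_square_divisor:
  assumes "d\<^sup>2 dvd N" "d \<ge> 3" "N > 0"
  shows "\<not> monomially_irreducible N"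
proof -
  obtain m where m: "N = d\<^sup>2 * m" using assms by blast
  have pos: "d * m > 0" using m assms by auto
  have "3 * 1 \<le> d * (d * m)" using assms pos by (intro mult_mono) auto
  then have "N \<ge> 2" by (simp add: m power2_eq_square)
  moreover have "[int (d * m) ^ 2 = 0] (mod int N)"
    by (simp add: cong_0_iff m power2_eq_square)
  moreover have "\<not> [2 * int (d * m) = 0] (mod int N)"
  proof
    assume "[2 * int (d * m) = 0] (mod int N)"
    then have "int N dvd int (2 * (d * m))"
      by (simp add: cong_0_iff)
    then have "N dvd 2 * (d * m)" by (simp only: of_nat_dvd_iff)
    then have "d * (d * m) \<le> 2 * (d * m)"
      using pos by (intro dvd_imp_le) (simp_all add: m power2_eq_square)
    then have "d \<le> 2" using pos by (simp only: mult_le_cancel2)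
    with assms show False by simp
  qed
  ultimately show ?thesis by (rule reducible_square_zero)
qed

text \<open>
  A prime \<open>p \<ge> 5\<close> dividing a composite \<open>N\<close> either divides it twice or splits off as a coprime factor;
  both cases are excluded.  So only 2 and 3 divide \<open>N\<close>, and the squares of \<open>4\<close> and \<open>3\<close> do not.
\<close>

lemma dvd_24_of_monomially_irreducible:
  assumes N: "N \<ge> 2" and irr: "monomially_irreducible N" and np: "\<not> prime N"
  shows "N dvd 24"
proof -
  have sq: "\<not> d\<^sup>2 dvd N" if "d \<ge> 3" for d
    using reducible_square_divisor[of d N] that irr N by auto
  have small: "p = 2 \<or> p = 3" if p: "prime p" "p dvd N" for p
  proof (rule ccontr)
    assume "\<not> (p = 2 \<or> p = 3)"
    then have ne: "p \<noteq> 2" "p \<noteq> 3" by auto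
    have p3: "p \<ge> 3" using prime_ge_2_nat[OF p(1)] ne by linarith
    have "prime (2 :: nat)" "prime (3 :: nat)" by simp_all
    then have "coprime p 2" "coprime p 3"
      using ne p(1) primes_coprime by blast+
    then have "coprime p (2 * 3)" by (simp only: coprime_mult_right_iff)
    then have p6: "coprime p 6" by simp
    obtain A where A: "N = p * A" using p(2) by (rule dvdE)
    have "\<not> p dvd A"
    proof
      assume "p dvd A"
      then have "p\<^sup>2 dvd N" unfolding A power2_eq_square by (intro mult_dvd_mono) auto
      with sq[OF p3] show False by blast
    qed
    then have "coprime A p" using prime_imp_coprime[OF p(1)] coprime_commute by blast
    moreover have "A \<noteq> 0" using A N by (cases "A = 0") simp_all
    moreover have "A \<noteq> 1" using A np p(1) by auto
    ultimately have "\<not> monomially_irreducible (A * p)"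
      using p3 p6 by (intro reducible_coprime_product) linarith+
    with irr A show False by (simp only: mult.commute)
  qed
  have "N \<noteq> 0" using N by simp
  obtain M where M0: "N = 2 ^ multiplicity 2 N * M" "\<not> 2 dvd M"
    by (rule multiplicity_decompose'[of N 2]) (use \<open>N \<noteq> 0\<close> in auto)
  define a where "a = multiplicity 2 N"
  have M: "\<not> 2 dvd M" "N = 2 ^ a * M" unfolding a_def by (fact M0)+
  have "M \<noteq> 0" using M(1) by (cases "M = 0") simp_all
  obtain L where L0: "M = 3 ^ multiplicity 3 M * L" "\<not> 3 dvd L"
    by (rule multiplicity_decompose'[of M 3]) (use \<open>M \<noteq> 0\<close> in auto)
  define b where "b = multiplicity 3 M"
  have L: "\<not> 3 dvd L" "M = 3 ^ b * L" unfolding b_def by (fact L0)+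
  have "L = 1"
  proof (rule ccontr)
    assume "L \<noteq> 1"
    then obtain p where p: "prime p" "p dvd L" using prime_factor_nat by blast
    have "p dvd N" unfolding M(2) L(2) by (intro dvd_mult p(2))
    from small[OF p(1) this] show False
    proof
      assume "p = 2"
      with p(2) M(1) show False unfolding L(2) by (metis dvd_mult)
    next
      assume "p = 3"
      with p(2) L(1) show False by simp
    qed
  qed
  have "a \<le> 3"
  proof (rule ccontr)
    assume "\<not> a \<le> 3"
    then have "2 ^ 4 dvd (2::nat) ^ a" by (intro le_imp_power_dvd) simp
    then have "4\<^sup>2 dvd N" unfolding M(2) by (intro dvd_mult2) simp
    then show False using sq[of 4] by simp
  qed
  then have a: "2 ^ a dvd (2::nat) ^ 3" by (rule le_imp_power_dvd)
  have "b \<le> 1"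
  proof (rule ccontr)
    assume "\<not> b \<le> 1"
    then have "3 ^ 2 dvd (3::nat) ^ b" by (intro le_imp_power_dvd) simp
    then have "3\<^sup>2 dvd N" unfolding M(2) L(2) by (intro dvd_mult dvd_mult2)
    then show False using sq[of 3] by simp
  qed
  then have "3 ^ b dvd (3::nat) ^ 1" by (rule le_imp_power_dvd)
  from mult_dvd_mono[OF a this] show ?thesis
    unfolding M(2) L(2) \<open>L = 1\<close> by simp
qed

theorem mainTheorem1:
  fixes N :: nat
  assumes "N \<ge> 2"
  shows "(prime N \<or> N \<in> {4, 6, 8, 12, 24} \<longrightarrow> monomially_irreducible N) \<and>
    (even N \<longrightarrow> (monomially_irreducible N \<longleftrightarrow> N \<in> {2, 4, 6, 8, 12, 24})) \<and>
    (odd N \<and> \<not> prime N \<longrightarrow> monomially_irreducible N \<longrightarrow>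
       (\<exists>(r::nat) (p :: nat \<Rightarrow> nat). r \<ge> 2 \<and> inj_on p {1..r} \<and>
          (\<forall>i\<in>{1..r}. prime (p i) \<and> odd (p i)) \<and>
          N = (\<Prod>i\<in>{1..r}. p i) \<and>
          (\<forall>i\<in>{1..r}. [int (p i) = 3] (mod 5) \<or> [int (p i) = - 3] (mod 5)) \<and>
          (\<forall>i\<in>{1..r}. [int (p i) = 3] (mod 8) \<or> [int (p i) = - 3] (mod 8)) \<and>
          (\<forall>i\<in>{1..r}. p i \<le> 1000 \<longrightarrow> p i \<in> Omega)))"
proof -
  have irr: "monomially_irreducible N" if "prime N \<or> N \<in> {4, 6, 8, 12, 24}"
    using that monomially_irreducible_prime monomially_irreducible_divisor_24 by blast
  have "N \<in> {2, 4, 6, 8, 12, 24} \<or> prime N" if "monomially_irreducible N"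
  proof (cases "prime N")
    case False
    have N: "N dvd 24"
      using dvd_24_of_monomially_irreducible[OF assms that False] .
    then have "N \<in> set [1..<25]"
      using assms dvd_imp_le[OF N] by auto
    moreover have "\<forall>n\<in>set [1..<25]. n dvd 24 \<longrightarrow> n \<in> {1, 2, 3, 4, 6, 8, 12, 24 :: nat}"
      by code_simp
    ultimately have "N \<in> {1, 2, 3, 4, 6, 8, 12, 24}" using N by blast
    with False assms show ?thesis by auto
  qed simp
  then have conv: "N \<in> {2, 4, 6, 8, 12, 24}" if "monomially_irreducible N" "even N \<or> \<not> prime N"
    using that primes_dvd_imp_eq[of 2 N] by auto
  have "monomially_irreducible N" if "N \<in> {2, 4, 6, 8, 12, 24}"
    using that by (intro irr) auto
  moreover have False if "monomially_irreducible N" "odd N \<and> \<not> prime N"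
    using conv that by auto
  ultimately show ?thesis
    using irr conv by blast
qed

end
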